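(* In the Gaussian linear model $Y=X\beta^\star+\xi$, $\xi\sim\mathcal N_n(0,\Sigma)$ with known $\Sigma$, where $R=X^\top\Sigma X$ satisfies $R_{ii}=1$ for all $i\in\{1,\dots,p\}$, it holds under $\mathbb H_1$ (that is, when $\beta^\star\notin\ker(X)$) that $$\alpha^{-1}\,\mathbb P_{\mu^\star}\{S\le\alpha\}\ \longrightarrow\ +\infty\qquad\text{as }\alpha\text{ goes to zero},$$ where $\mu^\star=(X^\top X)\beta^\star$ and $\mathbb P_{\mu^\star}$ denotes the law of $X^\top Y\sim\mathcal N_p(\mu^\star,R)$.
   Context: Let $X\in\mathbb R^{n\times p}$ be a design matrix with pairwise different columns $X_1,\dots,X_p$, let $\Sigma\in\mathbb R^{n\times n}$ be a (known) variance-covariance matrix, let $\beta^\star\in\mathbb R^p$, and observe $Y=X\beta^\star+\xi$ with $\xi\sim\mathcal N_n(0,\Sigma)$. Put $U:=X^\top Y\sim\mathcal N_p(\mu^\star,R)$ with $\mu^\star:=X^\top X\beta^\star$ and $R:=X^\top\Sigma X$. The hypotheses are $\mathbb H_0:\ \beta^\star\in\ker(X)$ (equivalently $\mu^\star=0$) against $\mathbb H_1:\ \beta^\star\notin\ker(X)$ (equivalently $\mu^\star\ne0$). Let $(\hat\imath,\hat\varepsilon)\in\{1,\dots,p\}\times\{\pm1\}$ be the (almost surely unique) pair with $\hat\varepsilon U_{\hat\imath}=\|U\|_\infty$. Set $\lambda_1:=\hat\varepsilon U_{\hat\imath}$ and $$\lambda_2:=\max_{1\le j\le p,\ j\neq\hat\imath}\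 \max\Big\{\frac{U_j-R_{j\hat\imath}U_{\hat\imath}}{1-\hat\varepsilon R_{j\hat\imath}},\ \frac{-U_j+R_{j\hat\imath}U_{\hat\imath}}{1+\hat\varepsilon R_{j\hat\imath}}\Big\}.$$ Let $\Phi$ be the standard normal cumulative distribution function and $\bar\Phi:=1-\Phi$. The test statistic is $S:=\bar\Phi(\lambda_1)/\bar\Phi(\lambda_2)$. *)

theory Defs
  imports "HOL-Probability.Probability"
begin

definition covariance_matrix :: "real^'n^'n \<Rightarrow> bool" where
  "covariance_matrix \<Sigma> \<longleftrightarrow> transpose \<Sigma> = \<Sigma> \<and> (\<forall>v. 0 \<le> v \<bullet> (\<Sigma> *v v))"

definition std_gaussian :: "(real^'n) measure" where
  "std_gaussian = density lborel (\<lambda>z. ennreal (\<Prod>i\<in>UNIV. std_normal_density (z $ i)))"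

text \<open>
  A random vector has law \<open>N(m, \<Sigma>)\<close> if it is distributed as \<open>m + A Z\<close>, where \<open>Z\<close> is
  standard Gaussian and \<open>A A\<^sup>T = \<Sigma>\<close>.  The law does not depend on the choice of the
  factor \<open>A\<close>, and \<open>\<Sigma>\<close> may be singular.
\<close>

definition gaussian_vector ::
    "'a measure \<Rightarrow> ('a \<Rightarrow> real^'n) \<Rightarrow> real^'n \<Rightarrow> real^'n^'n \<Rightarrow> bool" where
  "gaussian_vector M \<xi> m \<Sigma> \<longleftrightarrow>
     \<xi> \<in> borel_measurable M \<and>
     (\<exists>A :: real^'n^'n. A ** transpose A = \<Sigma> \<and>
        distr M borel \<xi> = distr std_gaussian borel (\<lambda>z. m + A *v z))"

definition Phi :: "real \<Rightarrow> real" where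
  "Phi x = cdf std_normal_distribution x"

definition Phi_bar :: "real \<Rightarrow> real" where
  "Phi_bar x = 1 - Phi x"

text \<open>
  If several pairs attain the maximum, one of them is chosen; the choice depends on \<open>u\<close> only
  through the set of maximising pairs.
\<close>

definition argmax_pair :: "real^'p \<Rightarrow> 'p \<times> real" where
  "argmax_pair u = (SOME (i, e). e \<in> {-1, 1} \<and> e * u $ i = infnorm u)"

definition lambda1 :: "real^'p \<Rightarrow> real" where
  "lambda1 u = (case argmax_pair u of (i, e) \<Rightarrow> e * u $ i)"

text \<open>
  A denominator vanishes only for \<open>|R $ j $ i| = 1\<close>; the quotient is then \<open>0\<close>.  For \<open>i\<close>, \<open>e\<close>
  a maximising pair, the numerator is in that case \<open>\<le> 0\<close>, while the other of the two
  quotients is \<open>\<ge> 0\<close>, so that the convention does not affect a maximum in which the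
  quotient is read as its limit \<open>-\<infinity>\<close> (and as \<open>0\<close> when the numerator vanishes as well).
  For a single column, the maximum is over the empty set and is an unspecified constant.
\<close>

definition lambda2 :: "real^'p^'p \<Rightarrow> real^'p \<Rightarrow> real" where
  "lambda2 R u = (case argmax_pair u of (i, e) \<Rightarrow>
     Max ((\<lambda>j. max ((u $ j - R $ j $ i * u $ i) / (1 - e * R $ j $ i))
                   ((- u $ j + R $ j $ i * u $ i) / (1 + e * R $ j $ i))) ` (UNIV - {i})))"

definition spacing_stat :: "real^'p^'p \<Rightarrow> real^'p \<Rightarrow> real" where
  "spacing_stat R u = Phi_bar (lambda1 u) / Phi_bar (lambda2 R u)"

end

theory Submission
  imports Defs
begin

text \<open>
  Fix a coordinate \<open>i\<close> with \<open>\<mu> $ i \<noteq> 0\<close>, where \<open>\<mu> = X\<^sup>T X \<beta>\<close>; one exists because \<open>\<beta>\<close> is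
  not in the kernel of \<open>X\<close>.  The coordinate \<open>U $ i\<close> is independent of the residuals
  \<open>U $ k - R $ k $ i * U $ i\<close>.  Hence, at the price of a constant factor in the probability, the
  residuals may be assumed bounded, and then \<open>lambda2\<close> is bounded by a constant
  \<open>K\<close> as soon as \<open>\<bar>U $ i\<bar>\<close> is large (\<open>lambda2_bounded_near_line\<close>).  On this event,
  \<open>S \<le> Phi_bar \<bar>U $ i\<bar> / Phi_bar K\<close>, so that \<open>S \<le> \<alpha>\<close> holds once \<open>\<bar>U $ i\<bar>\<close> exceeds the point
  \<open>t\<close> with \<open>Phi_bar t = \<alpha> * Phi_bar K\<close>.  In the direction of the sign of \<open>\<mu> $ i\<close>, this has
  probability \<open>Phi_bar (t - \<bar>\<mu> $ i\<bar>)\<close>.  The resulting bound is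
  \<open>P (S \<le> \<alpha>) \<ge> c * Phi_bar (t - \<bar>\<mu> $ i\<bar>)\<close> (\<open>gaussian_spacing_stat_lower_bound\<close>), and a
  translated Gaussian tail is infinitely heavier than the tail itself:
  \<open>Phi_bar (t - m) / Phi_bar t \<ge> exp (m * t - m\<^sup>2 / 2)\<close> (\<open>Phi_bar_shift_ge\<close>).  Dividing by
  \<open>\<alpha> = Phi_bar t / Phi_bar K\<close> and letting \<open>\<alpha>\<close> tend to \<open>0\<close> gives the claim
  (\<open>filterlim_gaussian_tail_shift\<close>).

  The coordinate \<open>i\<close> need not be the maximising one.  If \<open>U $ i\<close> is large and the residuals are
  bounded, a maximising index is perfectly correlated with \<open>i\<close>, and perfectly correlated indices
  give the same residuals up to bounded terms.

  Independence enters through the geometry of the standard Gaussian vector \<open>z\<close> with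
  \<open>U = \<mu> + B z\<close>: its law is invariant under rotations (\<open>distr_std_gaussian_orthogonal\<close>), because
  Lebesgue measure is (\<open>distr_lborel_orthogonal\<close>) and its density depends on the norm alone; one
  may therefore rotate the \<open>i\<close>-th row of \<open>B\<close> to a coordinate axis and use that the coordinates of
  \<open>z\<close> are independent (\<open>std_gaussian_near_ray\<close>).

  Finally, the probability in question is that of a Borel event: the maximising pair takes finitely
  many values, each on a Borel set (\<open>borel_spacing_stat_le\<close>).  This is what permits bounding it
  from below by the probability of a smaller event.
\<close>

section \<open>The tail of the standard normal law\<close>

lemma std_normal_distribution_pos:
  assumes "A \<in> sets borel" "emeasure lborel A \<noteq> 0"
  shows "0 < measure std_normal_distribution A"
proof -
  interpret N: real_distribution std_normal_distribution
    by (rule real_dist_normal_dist)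
  have "A \<notin> null_sets std_normal_distribution"
  proof
    assume "A \<in> null_sets std_normal_distribution"
    then have "AE x in lborel. x \<in> A \<longrightarrow> ennreal (std_normal_density x) = 0"
      using assms(1) by (subst (asm) null_sets_density_iff) auto
    moreover have "ennreal (std_normal_density x) \<noteq> 0" for x
      using normal_density_pos[of 1 0 x] by (simp del: normal_density_pos)
    ultimately have "AE x in lborel. x \<notin> A" by simp
    then have "A \<in> null_sets lborel"
      using assms(1) by (simp add: AE_iff_null_sets)
    with assms(2) show False by auto
  qed
  then have "emeasure std_normal_distribution A \<noteq> 0"
    using assms(1) by (auto intro: null_setsI)
  then show ?thesis
    by (simp add: N.emeasure_eq_measure zero_less_measure_iff)
qed

lemma Phi_bar_eq_measure: "Phi_bar t = measure std_normal_distribution {t<..}"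
proof -
  interpret N: real_distribution std_normal_distribution
    by (rule real_dist_normal_dist)
  have "{t<..} = space std_normal_distribution - {..t}" by auto
  then show ?thesis
    unfolding Phi_bar_def Phi_def cdf_def using N.prob_compl[of "{..t}"] by simp
qed

lemma Phi_bar_pos: "0 < Phi_bar t"
  unfolding Phi_bar_eq_measure
proof (rule std_normal_distribution_pos)
  show "emeasure lborel {t<..} \<noteq> 0"
  proof
    assume "emeasure lborel {t<..} = 0"
    moreover have "emeasure lborel {t<..<t+1} \<le> emeasure lborel {t<..}"
      by (rule emeasure_mono) auto
    ultimately show False by simp
  qed
qed simp

lemma Phi_bar_antimono: "s \<le> t \<Longrightarrow> Phi_bar t \<le> Phi_bar s"
proof -
  interpret N: real_distribution std_normal_distribution
    by (rule real_dist_normal_dist)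
  show "s \<le> t \<Longrightarrow> Phi_bar t \<le> Phi_bar s"
    unfolding Phi_bar_def Phi_def using N.cdf_nondecreasing by simp
qed

lemma borel_measurable_Phi_bar [measurable]: "Phi_bar \<in> borel_measurable borel"
proof -
  have "mono (\<lambda>x. - Phi_bar x)" by (auto intro!: monoI Phi_bar_antimono)
  then have "(\<lambda>x. - (- Phi_bar x)) \<in> borel_measurable borel"
    by (intro borel_measurable_uminus borel_measurable_mono)
  then show ?thesis by simp
qed

lemma continuous_Phi_bar: "isCont Phi_bar x"
proof -
  interpret N: real_distribution std_normal_distribution
    by (rule real_dist_normal_dist)
  have "emeasure std_normal_distribution {x} = 0"
  proof -
    have "{x} \<in> null_sets std_normal_distribution"
    proof (subst null_sets_density_iff, simp, intro conjI)
      show "AE y\<in>{x} in lborel. ennreal (std_normal_density y) = 0"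
        using AE_lborel_singleton[of x] by eventually_elim simp
    qed simp
    then show ?thesis by auto
  qed
  then have "isCont (cdf std_normal_distribution) x"
    unfolding N.isCont_cdf by (simp add: measure_def)
  then show ?thesis
    unfolding Phi_bar_def Phi_def by (intro continuous_intros)
qed

lemma Phi_bar_tendsto_0: "(Phi_bar \<longlongrightarrow> 0) at_top"
proof -
  interpret N: real_distribution std_normal_distribution
    by (rule real_dist_normal_dist)
  have "((\<lambda>x. 1 - cdf std_normal_distribution x) \<longlongrightarrow> 1 - 1) at_top"
    by (intro tendsto_intros N.cdf_lim_at_top_prob)
  then show ?thesis unfolding Phi_bar_def Phi_def by simp
qed

lemma Phi_bar_attains:
  assumes "0 < y" "y \<le> Phi_bar t"
  obtains s where "t \<le> s" "Phi_bar s = y"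
proof -
  have "eventually (\<lambda>s. Phi_bar s < y \<and> t \<le> s) at_top"
    using order_tendstoD(2)[OF Phi_bar_tendsto_0 assms(1)] eventually_ge_at_top
    by (rule eventually_conj)
  then obtain b where b: "Phi_bar b < y" "t \<le> b"
    using eventually_happens[of _ at_top] by fastforce
  have "\<exists>s\<ge>t. s \<le> b \<and> Phi_bar s = y"
    by (rule IVT2) (use b assms continuous_Phi_bar in auto)
  then show ?thesis using that by blast
qed

text \<open>
  Completing the square: translating the standard normal density by \<open>m\<close> multiplies it by an
  exponential factor that is nondecreasing in \<open>s\<close> for \<open>m \<ge> 0\<close>.
\<close>
lemma std_normal_density_shift:
  "std_normal_density (s - m) = exp (m * s - m\<^sup>2 / 2) * std_normal_density s"
proof -
  have "- (s - m)\<^sup>2 / 2 = (m * s - m\<^sup>2 / 2) + (- s\<^sup>2 / 2)"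
    by (simp add: power2_eq_square field_simps)
  then have "exp (- (s - m)\<^sup>2 / 2) = exp (m * s - m\<^sup>2 / 2) * exp (- s\<^sup>2 / 2)"
    by (simp only: exp_add)
  then show ?thesis
    unfolding std_normal_density_def by simp
qed

text \<open>
  On the tail beyond \<open>t\<close> the factor of the preceding identity is at least its value at \<open>t\<close>.
  This is what makes a translated Gaussian tail infinitely heavier than the original one: the
  ratio of the two tails is at least \<open>exp (m * t - m\<^sup>2 / 2)\<close>.
\<close>
lemma Phi_bar_shift_ge:
  assumes "0 \<le> m"
  shows "exp (m * t - m\<^sup>2 / 2) * Phi_bar t \<le> Phi_bar (t - m)"
proof -
  interpret N: real_distribution std_normal_distribution
    by (rule real_dist_normal_dist)
  let ?\<phi> = "std_normal_density" and ?c = "exp (m * t - m\<^sup>2 / 2)"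
  have tail: "ennreal (Phi_bar a) = (\<integral>\<^sup>+ s. ennreal (?\<phi> s) * indicator {a<..} s \<partial>lborel)" for a
    unfolding Phi_bar_eq_measure N.emeasure_eq_measure[symmetric]
    by (subst emeasure_density) auto
  have "ennreal (?c * Phi_bar t) = (\<integral>\<^sup>+ s. ennreal ?c * (ennreal (?\<phi> s) * indicator {t<..} s) \<partial>lborel)"
    by (subst nn_integral_cmult) (auto simp: tail[symmetric] ennreal_mult' less_imp_le[OF Phi_bar_pos])
  also have "\<dots> \<le> (\<integral>\<^sup>+ s. ennreal (?\<phi> (s - m)) * indicator {t<..} s \<partial>lborel)"
  proof (rule nn_integral_mono)
    fix s :: real
    have "?c * ?\<phi> s \<le> ?\<phi> (s - m)" if "t < s"
      unfolding std_normal_density_shift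
      using that assms by (intro mult_right_mono) (auto intro: mult_left_mono)
    then show "ennreal ?c * (ennreal (?\<phi> s) * indicator {t<..} s)
        \<le> ennreal (?\<phi> (s - m)) * indicator {t<..} s"
      by (auto simp: indicator_def ennreal_mult'[symmetric] intro: ennreal_leI)
  qed
  also have "\<dots> = (\<integral>\<^sup>+ s. ennreal (?\<phi> s) * indicator {t - m<..} s \<partial>lborel)"
  proof -
    have "(\<integral>\<^sup>+ s. ennreal (?\<phi> s) * indicator {t - m<..} s \<partial>lborel)
        = \<bar>1 :: real\<bar> * (\<integral>\<^sup>+ s. ennreal (?\<phi> (- m + 1 * s)) * indicator {t - m<..} (- m + 1 * s) \<partial>lborel)"
      by (rule nn_integral_real_affine) auto
    also have "\<dots> = (\<integral>\<^sup>+ s. ennreal (?\<phi> (s - m)) * indicator {t<..} s \<partial>lborel)"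
      by (auto intro!: nn_integral_cong simp: indicator_def)
    finally show ?thesis by simp
  qed
  also have "\<dots> = ennreal (Phi_bar (t - m))" by (rule tail[symmetric])
  finally show ?thesis
    by (simp add: ennreal_le_iff less_imp_le[OF Phi_bar_pos])
qed

text \<open>
  The analytic core of the power statement.  When \<open>\<alpha>\<close> is small, choose \<open>t\<close> with
  \<open>Phi_bar (t + m) = \<alpha> * \<kappa>\<close>.  Such a \<open>t\<close> is large, and the hypothesis then bounds
  \<open>P \<alpha> / \<alpha>\<close> from below by \<open>c * \<kappa>\<close> times the tail ratio
  \<open>Phi_bar t / Phi_bar (t + m)\<close>, which is unbounded.  In the application \<open>m\<close> is the size of
  a nonzero coordinate of the mean.
\<close>
lemma filterlim_gaussian_tail_shift:
  assumes pos: "0 < c" "0 < \<kappa>" "0 < m"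
    and lower: "\<And>\<alpha> t. T \<le> t \<Longrightarrow> Phi_bar (t + m) \<le> \<alpha> * \<kappa> \<Longrightarrow> c * Phi_bar t \<le> P \<alpha>"
  shows "filterlim (\<lambda>\<alpha>. inverse \<alpha> * P \<alpha>) at_top (at_right 0)"
  unfolding filterlim_at_top
proof
  fix Z :: real
  define b where "b = \<bar>Z\<bar> + 1"
  define t1 where "t1 = max (T + m) ((ln (b / (c * \<kappa>)) + m\<^sup>2 / 2) / m)"
  have b: "0 < b" "Z \<le> b" by (auto simp: b_def)
  \<comment> \<open>The second term of \<open>t1\<close> is the point beyond which the tail ratio is at least \<open>b / (c * \<kappa>)\<close>.\<close>
  have large: "b \<le> c * exp (m * t - m\<^sup>2 / 2) * \<kappa>" if "t1 \<le> t" for t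
  proof -
    have "(ln (b / (c * \<kappa>)) + m\<^sup>2 / 2) / m \<le> t" using that by (simp add: t1_def)
    then have "ln (b / (c * \<kappa>)) \<le> m * t - m\<^sup>2 / 2" using pos by (simp add: field_simps)
    then have "b / (c * \<kappa>) \<le> exp (m * t - m\<^sup>2 / 2)"
      using b pos by (metis divide_pos_pos exp_le_cancel_iff exp_ln mult_pos_pos)
    then show ?thesis using pos by (simp add: field_simps)
  qed
  have "Z \<le> inverse \<alpha> * P \<alpha>" if \<alpha>: "0 < \<alpha>" "\<alpha> < Phi_bar t1 / \<kappa>" for \<alpha>
  proof -
    have "0 < \<alpha> * \<kappa>" "\<alpha> * \<kappa> \<le> Phi_bar t1" using \<alpha> pos by (auto simp: field_simps)
    then obtain t where t: "t1 \<le> t" "Phi_bar t = \<alpha> * \<kappa>" by (rule Phi_bar_attains)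
    \<comment> \<open>Here \<open>t\<close> is the point written \<open>t + m\<close> in the hypothesis, which is used at \<open>t - m\<close>.\<close>
    have "b * \<alpha> \<le> c * exp (m * t - m\<^sup>2 / 2) * \<kappa> * \<alpha>"
      using large[OF t(1)] \<alpha> by (intro mult_right_mono) auto
    also have "\<dots> = c * (exp (m * t - m\<^sup>2 / 2) * Phi_bar t)" using t by simp
    also have "\<dots> \<le> c * Phi_bar (t - m)"
      using Phi_bar_shift_ge[of m t] pos by (intro mult_left_mono) auto
    also have "\<dots> \<le> P \<alpha>" using t by (intro lower) (auto simp: t1_def)
    finally have "b \<le> inverse \<alpha> * P \<alpha>" using \<alpha> by (simp add: field_simps)
    with b show ?thesis by simp
  qed
  then show "\<forall>\<^sub>F \<alpha> in at_right 0. Z \<le> inverse \<alpha> * P \<alpha>"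
    using pos Phi_bar_pos[of t1]
    by (auto simp: eventually_at_right_field intro!: exI[of _ "Phi_bar t1 / \<kappa>"])
qed

section \<open>Measurability of the test statistic\<close>

text \<open>
  The choice made by \<^const>\<open>argmax_pair\<close> is a function of this set alone, and the set ranges
  over the finitely many subsets of the signed indices; hence ties do not harm measurability.
\<close>
definition maximisers :: "real^'p \<Rightarrow> ('p \<times> real) set" where
  "maximisers u = {(i, e). e \<in> {-1, 1} \<and> e * u $ i = infnorm u}"

lemma maximisers_nonempty: "maximisers (u :: real^'p) \<noteq> {}"
proof -
  have "infnorm u \<in> (\<lambda>b. \<bar>u \<bullet> b\<bar>) ` Basis"
    unfolding infnorm_Max by (intro Max_in) auto
  then obtain i where "infnorm u = \<bar>u $ i\<bar>"
    by (auto simp: Basis_vec_def inner_axis)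
  then have "(i, if u $ i \<ge> 0 then 1 else -1) \<in> maximisers u"
    by (auto simp: maximisers_def)
  then show ?thesis by blast
qed

lemma argmax_pair_eq: "argmax_pair u = (SOME x. x \<in> maximisers u)"
  unfolding argmax_pair_def maximisers_def by simp

lemma argmax_pair_in: "argmax_pair u \<in> maximisers u"
  unfolding argmax_pair_eq using maximisers_nonempty by (simp add: some_in_eq)

lemma argmax_pair_cases:
  obtains i e where "argmax_pair u = (i, e)" "e = -1 \<or> e = 1" "e * u $ i = infnorm u"
  using argmax_pair_in[of u] by (cases "argmax_pair u") (auto simp: maximisers_def)

lemma borel_measurable_infnorm [measurable]: "(infnorm :: real^'p \<Rightarrow> real) \<in> borel_measurable borel"
  by (intro borel_measurable_continuous_onI continuous_intros)

text \<open>
  Each condition \<open>maximisers u = a\<close> is a finite conjunction of closed conditions on \<open>u\<close> and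
  their negations, and the chosen pair is \<open>x\<close> exactly for finitely many values of \<open>a\<close>.
\<close>
lemma borel_argmax_pair: "{u. argmax_pair (u :: real^'p) = x} \<in> sets borel"
proof -
  let ?D = "UNIV \<times> {-1, 1} :: ('p \<times> real) set"
  have sub: "maximisers u \<subseteq> ?D" for u :: "real^'p" by (auto simp: maximisers_def)
  have elem: "{u. (y \<in> maximisers u) = (y \<in> a)} \<in> sets borel" for y and a :: "('p \<times> real) set"
  proof (cases y)
    case (Pair i e)
    have "Measurable.pred borel (\<lambda>u :: real^'p. e \<in> {-1, 1} \<and> e * u $ i = infnorm u)"
      by measurable
    then have "Measurable.pred borel (\<lambda>u :: real^'p. (y \<in> maximisers u) = (y \<in> a))"
      unfolding Pair maximisers_def by simp
    then show ?thesis by (simp add: pred_def)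
  qed
  have "{u :: real^'p. argmax_pair u = x} =
      (\<Union>a \<in> {a \<in> Pow ?D. (SOME y. y \<in> a) = x}. \<Inter>y \<in> ?D. {u. (y \<in> maximisers u) = (y \<in> a)})"
    (is "?L = ?R")
  proof
    show "?L \<subseteq> ?R"
    proof
      fix u :: "real^'p"
      assume "u \<in> ?L"
      then have "maximisers u \<in> {a \<in> Pow ?D. (SOME y. y \<in> a) = x}"
        using sub[of u] by (simp add: argmax_pair_eq)
      then show "u \<in> ?R" by blast
    qed
    show "?R \<subseteq> ?L"
    proof
      fix u :: "real^'p"
      assume "u \<in> ?R"
      then obtain a where a: "a \<subseteq> ?D" "(SOME y. y \<in> a) = x"
        "\<forall>y \<in> ?D. (y \<in> maximisers u) = (y \<in> a)" by blast
      then have "maximisers u = a" using sub[of u] by blast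
      then show "u \<in> ?L" using a by (simp add: argmax_pair_eq)
    qed
  qed
  also have "\<dots> \<in> sets borel"
    by (intro sets.finite_UN sets.finite_INT elem) auto
  finally show ?thesis .
qed

lemma borel_spacing_stat_le: "{u. spacing_stat R (u :: real^'p) \<le> \<alpha>} \<in> sets borel"
proof -
  let ?D = "UNIV \<times> {-1, 1} :: ('p \<times> real) set"
  define L2 where "L2 i e u = Max ((\<lambda>j. max ((u $ j - R $ j $ i * u $ i) / (1 - e * R $ j $ i))
                   ((- u $ j + R $ j $ i * u $ i) / (1 + e * R $ j $ i))) ` (UNIV - {i}))"
    for i and e :: real and u :: "real^'p"
  have [measurable]: "L2 i e \<in> borel_measurable borel" for i e
    unfolding L2_def by (intro borel_measurable_Max) auto
  have "{u. spacing_stat R u \<le> \<alpha>} =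
     (\<Union>x \<in> ?D. {u. argmax_pair u = x} \<inter>
        {u. Phi_bar (snd x * u $ fst x) / Phi_bar (L2 (fst x) (snd x) u) \<le> \<alpha>})" (is "?L = ?R")
  proof (rule set_eqI)
    fix u :: "real^'p"
    obtain i e where "argmax_pair u = (i, e)" "e = -1 \<or> e = 1"
      by (rule argmax_pair_cases[of u])
    then show "u \<in> ?L \<longleftrightarrow> u \<in> ?R"
      by (auto simp: spacing_stat_def lambda1_def lambda2_def L2_def)
  qed
  also have "\<dots> \<in> sets borel"
    by (intro sets.finite_UN sets.Int borel_argmax_pair) (simp, measurable)
  finally show ?thesis .
qed

section \<open>The statistic far out along a column of the correlation matrix\<close>

text \<open>
  By the equality case of Cauchy-Schwarz, unit vectors \<open>a\<close> and \<open>b\<close> with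
  \<open>\<bar>a \<bullet> b\<bar> = 1\<close> satisfy \<open>a = (a \<bullet> b) *\<^sub>R b\<close>.  For a correlation matrix this says that the
  columns of two coordinates that are perfectly correlated agree up to sign.
\<close>
lemma gram_abs_one:
  fixes a b c :: "'v :: real_inner"
  assumes "norm a = 1" "norm b = 1" "\<bar>a \<bullet> b\<bar> = 1"
  shows "c \<bullet> a = (c \<bullet> b) * (a \<bullet> b)"
proof -
  have sq: "(a \<bullet> b)\<^sup>2 = 1" using assms(3) by (metis abs_power2 power2_abs power_one)
  have "(norm (a - (a \<bullet> b) *\<^sub>R b))\<^sup>2 = (a \<bullet> a) - 2 * (a \<bullet> b)\<^sup>2 + (a \<bullet> b)\<^sup>2 * (b \<bullet> b)"
    unfolding power2_norm_eq_inner
    by (simp add: inner_diff_left inner_diff_right inner_commute power2_eq_square algebra_simps)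
  also have "\<dots> = 0" using assms sq by (simp add: norm_eq_1)
  finally have "a = (a \<bullet> b) *\<^sub>R b" by simp
  then have "c \<bullet> a = c \<bullet> ((a \<bullet> b) *\<^sub>R b)" by simp
  then show ?thesis by simp
qed

text \<open>
  If the vector \<open>u\<close> stays componentwise within \<open>C\<close> of the line spanned by the \<open>i\<close>-th column
  of \<open>R\<close> and lies far out along it, then the maximising index \<open>j\<close> is perfectly correlated with
  \<open>i\<close>: every coordinate with \<open>\<bar>R $ j $ i\<bar> < 1\<close> is eventually dominated by the \<open>i\<close>-th one.
  Perfect correlation gives \<open>R $ k $ i = R $ k $ j * R $ j $ i\<close>, so that \<open>u\<close> is also near the
  line of the \<open>j\<close>-th column, and all numerators in \<^const>\<open>lambda2\<close> are at most \<open>2 * C\<close> in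
  absolute value.

  This form covers singular \<open>R\<close> and tied maxima without a case distinction.
\<close>
lemma lambda2_bounded_near_line:
  fixes R :: "real^'p^'p" and b :: "'p \<Rightarrow> 'v::real_inner"
  assumes gram: "\<And>j k. R $ j $ k = b j \<bullet> b k" and unit: "\<And>j. norm (b j) = 1" and "0 \<le> C"
  shows "\<exists>K T. \<forall>u. (\<forall>k. \<bar>u $ k - R $ k $ i * u $ i\<bar> \<le> C) \<longrightarrow> T < \<bar>u $ i\<bar> \<longrightarrow> lambda2 R u \<le> K"
proof -
  define q where "q j k = 2 * C / \<bar>1 - R $ k $ j\<bar> + 2 * C / \<bar>1 + R $ k $ j\<bar>" for j k
  have q_nonneg: "0 \<le> q j k" for j k using \<open>0 \<le> C\<close> by (simp add: q_def)
  \<comment> \<open>The first summand bounds \<^const>\<open>lambda2\<close> when there is only one index; the sum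
    dominates every quotient, whichever index and sign attain the maximum.\<close>
  define K where "K = \<bar>Max {} :: real\<bar> + (\<Sum>j\<in>UNIV. \<Sum>k\<in>UNIV. q j k)"
  define T where "T = (\<Sum>j\<in>UNIV. C / (1 - \<bar>R $ j $ i\<bar>))"
  have abs_le: "\<bar>R $ j $ k\<bar> \<le> 1" for j k
    using Cauchy_Schwarz_ineq2[of "b j" "b k"] by (simp add: gram unit)
  have "lambda2 R u \<le> K"
    if near: "\<And>k. \<bar>u $ k - R $ k $ i * u $ i\<bar> \<le> C" and far: "T < \<bar>u $ i\<bar>" for u
  proof -
    obtain j e where je: "argmax_pair u = (j, e)" "e = -1 \<or> e = 1" "e * u $ j = infnorm u"
      by (rule argmax_pair_cases)
    have "\<bar>u $ i\<bar> \<le> e * u $ j" using component_le_infnorm_cart[of u i] je by simp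
    then have max: "\<bar>u $ i\<bar> \<le> \<bar>u $ j\<bar>" using je(2) by auto
    have corr: "\<bar>R $ j $ i\<bar> = 1"
    proof (rule ccontr)
      assume "\<bar>R $ j $ i\<bar> \<noteq> 1"
      then have less: "\<bar>R $ j $ i\<bar> < 1" using abs_le[of j i] by simp
      have "C / (1 - \<bar>R $ j $ i\<bar>) \<le> T"
        unfolding T_def using abs_le \<open>0 \<le> C\<close> by (intro member_le_sum) auto
      then have "C / (1 - \<bar>R $ j $ i\<bar>) < \<bar>u $ i\<bar>" using far by simp
      then have "C < (1 - \<bar>R $ j $ i\<bar>) * \<bar>u $ i\<bar>" using less by (simp add: field_simps)
      moreover have "\<bar>u $ j\<bar> \<le> C + \<bar>R $ j $ i\<bar> * \<bar>u $ i\<bar>"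
        using near[of j] by (simp add: abs_mult[symmetric])
      ultimately show False using max by (simp add: algebra_simps)
    qed
    have num: "\<bar>u $ k - R $ k $ j * u $ j\<bar> \<le> 2 * C" for k
    proof -
      have "R $ k $ i = R $ k $ j * R $ j $ i"
        using gram_abs_one[of "b i" "b j" "b k"] corr by (simp add: gram unit inner_commute)
      then have "u $ k - R $ k $ j * u $ j
          = (u $ k - R $ k $ i * u $ i) - R $ k $ j * (u $ j - R $ j $ i * u $ i)"
        by (simp add: algebra_simps)
      moreover have "\<bar>R $ k $ j * (u $ j - R $ j $ i * u $ i)\<bar> \<le> 1 * C"
        unfolding abs_mult using near[of j] abs_le by (intro mult_mono) auto
      ultimately show ?thesis using near[of k] by linarith
    qed
    \<comment> \<open>For \<open>d = 0\<close> both quotients are \<open>0\<close>, so that degenerate denominators obey the same bound.\<close>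
    have quot: "x / d \<le> 2 * C / \<bar>d\<bar>" if "\<bar>x\<bar> \<le> 2 * C" for x d :: real
    proof -
      have "x / d \<le> \<bar>x\<bar> / \<bar>d\<bar>" by (metis abs_divide abs_ge_self)
      also have "\<dots> \<le> 2 * C / \<bar>d\<bar>" using that by (intro divide_right_mono) auto
      finally show ?thesis .
    qed
    have term_le: "max ((u $ k - R $ k $ j * u $ j) / (1 - e * R $ k $ j))
                   ((- u $ k + R $ k $ j * u $ j) / (1 + e * R $ k $ j)) \<le> K" (is "?m \<le> K") for k
    proof -
      have n2: "\<bar>- u $ k + R $ k $ j * u $ j\<bar> \<le> 2 * C" using num[of k] by linarith
      define r s where "r = 2 * C / \<bar>1 - R $ k $ j\<bar>" and "s = 2 * C / \<bar>1 + R $ k $ j\<bar>"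
      have rs: "0 \<le> r" "0 \<le> s" using \<open>0 \<le> C\<close> by (auto simp: r_def s_def)
      have "?m \<le> r + s"
      proof (cases "e = 1")
        case True
        then show ?thesis
          using quot[OF num[of k], of "1 - R $ k $ j", folded r_def] rs
            quot[OF n2, of "1 + R $ k $ j", folded s_def] by simp
      next
        case False
        with je(2) have "e = -1" by simp
        then show ?thesis
          using quot[OF num[of k], of "1 + R $ k $ j", folded s_def] rs
            quot[OF n2, of "1 - R $ k $ j", folded r_def] by simp
      qed
      also have "\<dots> = q j k" by (simp add: q_def r_def s_def)
      also have "\<dots> \<le> (\<Sum>k\<in>UNIV. q j k)" using q_nonneg by (intro member_le_sum) auto
      also have "\<dots> \<le> (\<Sum>j\<in>UNIV. \<Sum>k\<in>UNIV. q j k)"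
        by (rule member_le_sum[of j UNIV "\<lambda>j. \<Sum>k\<in>UNIV. q j k"]) (auto intro!: sum_nonneg q_nonneg)
      also have "\<dots> \<le> K" by (simp add: K_def)
      finally show ?thesis .
    qed
    show ?thesis
    proof (cases "UNIV - {j} = {}")
      case True
      have "0 \<le> (\<Sum>j\<in>UNIV. \<Sum>k\<in>UNIV. q j k)" by (intro sum_nonneg q_nonneg)
      then show ?thesis unfolding lambda2_def je(1) prod.case True K_def
        using abs_ge_self[of "Max {} :: real"] by simp
    next
      case False
      then show ?thesis
        unfolding lambda2_def je(1) prod.case by (subst Max_le_iff) (use term_le in auto)
    qed
  qed
  then show ?thesis by blast
qed

lemma spacing_stat_le:
  assumes "lambda2 R u \<le> K" "s \<le> \<bar>u $ i\<bar>"
  shows "spacing_stat R u \<le> Phi_bar s / Phi_bar K"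
proof -
  obtain j e where "argmax_pair u = (j, e)" "e * u $ j = infnorm u"
    by (rule argmax_pair_cases[of u])
  then have "s \<le> lambda1 u"
    using assms(2) component_le_infnorm_cart[of u i] by (simp add: lambda1_def)
  then show ?thesis
    unfolding spacing_stat_def using assms(1)
    by (intro frac_le Phi_bar_antimono Phi_bar_pos) (auto intro: less_imp_le Phi_bar_pos)
qed

section \<open>Rotation invariance of the standard Gaussian law\<close>

lemma borel_measurable_orthogonal:
  fixes f :: "'a::euclidean_space \<Rightarrow> 'a"
  assumes "orthogonal_transformation f"
  shows "f \<in> borel_measurable borel"
  using orthogonal_transformation_linear[OF assms]
  by (intro borel_measurable_continuous_onI linear_continuous_on)
    (simp add: linear_conv_bounded_linear)

lemma nn_integral_lborel_translate:
  fixes h :: "'a::euclidean_space \<Rightarrow> ennreal"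
  assumes [measurable]: "h \<in> borel_measurable borel"
  shows "(\<integral>\<^sup>+ x. h (c + x) \<partial>lborel) = (\<integral>\<^sup>+ x. h x \<partial>lborel)"
proof -
  have "(\<integral>\<^sup>+ x. h x \<partial>lborel) = (\<integral>\<^sup>+ x. h x \<partial>distr lborel borel ((+) c))"
    by (simp add: lborel_distr_plus)
  also have "\<dots> = (\<integral>\<^sup>+ x. h (c + x) \<partial>lborel)"
    by (rule nn_integral_distr) auto
  finally show ?thesis by simp
qed

text \<open>
  The uniqueness argument for Haar measure, in which the unit ball \<open>D\<close> is the reference set.
  With \<open>I\<close> denoting integration over \<open>x\<close> and \<open>z\<close>, translations and Tonelli's theorem give
  \<open>I (1\<^sub>D x * 1\<^sub>A (f z)) = I (1\<^sub>D (x - f z) * 1\<^sub>A (f z)) = I (1\<^sub>D (- f z) * 1\<^sub>A (f z + x))\<close>,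
  where the second equality translates \<open>z\<close> by the preimage of \<open>x\<close>.  Since \<open>f\<close> preserves norms,
  \<open>1\<^sub>D (- f z) = 1\<^sub>D z\<close>, and the last integral is the volume of \<open>D\<close> times that of \<open>A\<close>.  The
  volume of \<open>D\<close> is positive and finite and cancels.
\<close>
lemma distr_lborel_orthogonal:
  fixes f :: "'a::euclidean_space \<Rightarrow> 'a"
  assumes f: "orthogonal_transformation f"
  shows "distr lborel borel f = lborel"
proof (rule measure_eqI)
  have lin: "linear f" using f by (rule orthogonal_transformation_linear)
  note [measurable] = borel_measurable_orthogonal[OF f]
  have f_inv: "f (inv f x) = x" for x
    using orthogonal_transformation_surj[OF f] by (simp add: surj_f_inv_f)
  fix A :: "'a set"
  assume "A \<in> sets (distr lborel borel f)"
  then have [measurable]: "A \<in> sets borel" by simp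
  let ?D = "ball 0 1 :: 'a set"
  have [measurable]: "?D \<in> sets borel" by simp
  let ?d = "indicator ?D :: 'a \<Rightarrow> ennreal" and ?a = "indicator A :: 'a \<Rightarrow> ennreal"
  have "emeasure lborel ?D * emeasure (distr lborel borel f) A
      = (\<integral>\<^sup>+ z. (\<integral>\<^sup>+ x. ?d x * ?a (f z) \<partial>lborel) \<partial>lborel)"
  proof -
    have "emeasure (distr lborel borel f) A = (\<integral>\<^sup>+ z. ?a z \<partial>distr lborel borel f)"
      by simp
    also have "\<dots> = (\<integral>\<^sup>+ z. ?a (f z) \<partial>lborel)"
      by (rule nn_integral_distr) auto
    finally have "emeasure lborel ?D * emeasure (distr lborel borel f) A
        = (\<integral>\<^sup>+ z. emeasure lborel ?D * ?a (f z) \<partial>lborel)"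
      by (subst nn_integral_cmult) auto
    moreover have "emeasure lborel ?D * ?a (f z) = (\<integral>\<^sup>+ x. ?d x * ?a (f z) \<partial>lborel)" for z
    proof -
      have "?D \<in> sets lborel" by simp
      then show ?thesis by (simp only: nn_integral_multc borel_measurable_indicator nn_integral_indicator)
    qed
    ultimately show ?thesis by (simp only:)
  qed
  also have "\<dots> = (\<integral>\<^sup>+ z. (\<integral>\<^sup>+ x. ?d (- f z + x) * ?a (f z) \<partial>lborel) \<partial>lborel)"
    by (rule nn_integral_cong, rule nn_integral_lborel_translate
        [of "\<lambda>x. ?d x * ?a (f z)" "- f z" for z, symmetric]) measurable
  also have "\<dots> = (\<integral>\<^sup>+ x. (\<integral>\<^sup>+ z. ?d (- f z + x) * ?a (f z) \<partial>lborel) \<partial>lborel)"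
    by (rule lborel_pair.Fubini') measurable
  also have "\<dots> = (\<integral>\<^sup>+ x. (\<integral>\<^sup>+ z. ?d (- f (inv f x + z) + x) * ?a (f (inv f x + z)) \<partial>lborel) \<partial>lborel)"
    by (rule nn_integral_cong, rule nn_integral_lborel_translate
        [of "\<lambda>z. ?d (- f z + x) * ?a (f z)" "inv f x" for x, symmetric]) measurable
  also have "\<dots> = (\<integral>\<^sup>+ x. (\<integral>\<^sup>+ z. ?d z * ?a (f z + x) \<partial>lborel) \<partial>lborel)"
    by (intro nn_integral_cong)
      (simp add: linear_add[OF lin] f_inv indicator_def orthogonal_transformation_norm[OF f] add.commute)
  also have "\<dots> = (\<integral>\<^sup>+ z. (\<integral>\<^sup>+ x. ?d z * ?a (f z + x) \<partial>lborel) \<partial>lborel)"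
    by (rule lborel_pair.Fubini') measurable
  also have "\<dots> = (\<integral>\<^sup>+ z. (\<integral>\<^sup>+ x. ?d z * ?a x \<partial>lborel) \<partial>lborel)"
    by (rule nn_integral_cong, rule nn_integral_lborel_translate
        [of "\<lambda>x. ?d z * ?a x" "f z" for z]) measurable
  also have "\<dots> = emeasure lborel ?D * emeasure lborel A"
    by (simp add: nn_integral_multc nn_integral_cmult)
  finally have eq: "emeasure lborel ?D * emeasure (distr lborel borel f) A
      = emeasure lborel ?D * emeasure lborel A" .
  have "emeasure lborel ?D \<noteq> 0"
    using content_ball_pos[of 1 "0 :: 'a"] by (auto simp: measure_def)
  moreover have "emeasure lborel ?D \<noteq> \<top>"
    using emeasure_lborel_ball_finite[of "0 :: 'a" 1] by simp
  ultimately show "emeasure (distr lborel borel f) A = emeasure lborel A"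
    using eq by (simp add: ennreal_mult_cancel_left)
qed simp

lemma prod_std_normal_density:
  "(\<Prod>i\<in>UNIV. std_normal_density (z $ i)) = (1 / sqrt (2 * pi)) ^ CARD('n) * exp (- (norm z)\<^sup>2 / 2)"
  for z :: "real^'n"
proof -
  have "(norm z)\<^sup>2 = (\<Sum>i\<in>UNIV. (z $ i)\<^sup>2)"
    unfolding power2_norm_eq_inner inner_vec_def by (simp add: power2_eq_square)
  then have "(\<Prod>i\<in>UNIV. exp (- (z $ i)\<^sup>2 / 2)) = exp (- (norm z)\<^sup>2 / 2)"
    by (simp only: exp_sum[OF finite, symmetric] sum_negf sum_divide_distrib[symmetric])
  then show ?thesis
    unfolding std_normal_density_def prod.distrib by simp
qed

lemma sets_std_gaussian [simp, measurable_cong]: "sets std_gaussian = sets borel"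
  by (simp add: std_gaussian_def)

lemma space_std_gaussian [simp]: "space std_gaussian = UNIV"
  by (simp add: std_gaussian_def)

lemma distr_std_gaussian_orthogonal:
  fixes f :: "real^'n \<Rightarrow> real^'n"
  assumes f: "orthogonal_transformation f"
  shows "distr std_gaussian borel f = std_gaussian"
proof (rule measure_eqI)
  note [measurable] = borel_measurable_orthogonal[OF f]
  let ?g = "\<lambda>z :: real^'n. ennreal (\<Prod>i\<in>UNIV. std_normal_density (z $ i))"
  fix A assume "A \<in> sets (distr std_gaussian borel f)"
  then have [measurable]: "A \<in> sets borel" by simp
  have pre: "f -` A \<in> sets borel"
    using measurable_sets[of f borel borel A] by simp
  have "emeasure (distr std_gaussian borel f) A = emeasure std_gaussian (f -` A)"
    by (subst emeasure_distr) auto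
  also have "\<dots> = (\<integral>\<^sup>+ z. ?g z * indicator (f -` A) z \<partial>lborel)"
    unfolding std_gaussian_def using pre by (subst emeasure_density) auto
  also have "\<dots> = (\<integral>\<^sup>+ z. ?g (f z) * indicator A (f z) \<partial>lborel)"
    unfolding prod_std_normal_density orthogonal_transformation_norm[OF f]
    by (simp add: indicator_def)
  also have "\<dots> = (\<integral>\<^sup>+ w. ?g w * indicator A w \<partial>distr lborel borel f)"
    by (subst nn_integral_distr) auto
  also have "\<dots> = emeasure std_gaussian A"
    unfolding distr_lborel_orthogonal[OF f] std_gaussian_def by (subst emeasure_density) auto
  finally show "emeasure (distr std_gaussian borel f) A = emeasure std_gaussian A" .
qed simp

text \<open>
  Independence of the coordinates: density and Lebesgue measure are both products over the
  coordinate basis.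
\<close>
lemma emeasure_std_gaussian_product:
  fixes S :: "'n::finite \<Rightarrow> real set"
  assumes [measurable]: "\<And>i. S i \<in> sets borel"
  shows "emeasure std_gaussian {z :: real^'n. \<forall>i. z $ i \<in> S i}
    = (\<Prod>i\<in>UNIV. emeasure std_normal_distribution (S i))"
proof -
  have inj: "inj (\<lambda>i :: 'n. axis i (1 :: real))" by (auto simp: inj_on_def axis_eq_axis)
  define ix where "ix = inv (\<lambda>i :: 'n. axis i (1 :: real))"
  have ix: "ix (axis i 1) = i" for i unfolding ix_def by (rule inv_f_f[OF inj])
  have reindex: "(\<Prod>b\<in>Basis. h b) = (\<Prod>i\<in>UNIV. h (axis i 1))" for h :: "real^'n \<Rightarrow> 'b::comm_monoid_mult"
  proof -
    have "(Basis :: (real^'n) set) = range (\<lambda>i. axis i 1)" by (auto simp: Basis_vec_def)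
    then show ?thesis using prod.reindex[OF inj, of h] by simp
  qed
  define f where "f b x = std_normal_density x * indicator (S (ix b)) x" for b :: "real^'n" and x
  have [measurable]: "f b \<in> borel_measurable borel" for b unfolding f_def by measurable
  have [measurable]: "{z :: real^'n. \<forall>i. z $ i \<in> S i} \<in> sets borel" by measurable
  have "emeasure std_gaussian {z :: real^'n. \<forall>i. z $ i \<in> S i} =
      (\<integral>\<^sup>+ z. ennreal (\<Prod>i\<in>UNIV. std_normal_density (z $ i)) * indicator {z :: real^'n. \<forall>i. z $ i \<in> S i} z \<partial>lborel)"
    unfolding std_gaussian_def by (subst emeasure_density) auto
  also have "\<dots> = (\<integral>\<^sup>+ z. (\<Prod>b\<in>Basis. ennreal (f b (z \<bullet> b))) \<partial>lborel)"
  proof (rule nn_integral_cong)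
    fix z :: "real^'n"
    have "indicator {z :: real^'n. \<forall>i. z $ i \<in> S i} z = (\<Prod>i\<in>UNIV. indicator (S i) (z $ i) :: real)"
      by (auto simp: indicator_def prod_zero_iff)
    then have "(\<Prod>i\<in>UNIV. std_normal_density (z $ i)) * indicator {z :: real^'n. \<forall>i. z $ i \<in> S i} z
        = (\<Prod>i\<in>UNIV. f (axis i 1) (z \<bullet> axis i 1))"
      by (simp add: f_def ix inner_axis prod.distrib)
    moreover have "ennreal p * indicator D z = ennreal (p * indicator D z)" for p and D :: "(real^'n) set"
      by (simp add: indicator_def)
    ultimately have "ennreal (\<Prod>i\<in>UNIV. std_normal_density (z $ i)) * indicator {z :: real^'n. \<forall>i. z $ i \<in> S i} z
        = ennreal (\<Prod>i\<in>UNIV. f (axis i 1) (z \<bullet> axis i 1))"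
      by (simp only:)
    also have "\<dots> = (\<Prod>i\<in>UNIV. ennreal (f (axis i 1) (z \<bullet> axis i 1)))"
      by (rule prod_ennreal[symmetric]) (simp add: f_def)
    finally show "ennreal (\<Prod>i\<in>UNIV. std_normal_density (z $ i)) * indicator {z :: real^'n. \<forall>i. z $ i \<in> S i} z
        = (\<Prod>b\<in>Basis. ennreal (f b (z \<bullet> b)))"
      unfolding reindex .
  qed
  also have "\<dots> = (\<Prod>b\<in>Basis. (\<integral>\<^sup>+ x. ennreal (f b x) \<partial>lborel))"
    by (rule nn_integral_lborel_prod) (auto simp: f_def)
  also have "\<dots> = (\<Prod>i\<in>UNIV. emeasure std_normal_distribution (S i))"
    unfolding reindex
  proof (rule prod.cong[OF refl])
    fix i
    show "(\<integral>\<^sup>+ x. ennreal (f (axis i 1) x) \<partial>lborel) = emeasure std_normal_distribution (S i)"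
      by (subst emeasure_density)
        (auto simp: f_def ix indicator_def intro!: nn_integral_cong)
  qed
  finally show ?thesis .
qed

lemma prob_space_std_gaussian: "prob_space (std_gaussian :: (real^'n) measure)"
proof
  interpret N: real_distribution std_normal_distribution
    by (rule real_dist_normal_dist)
  show "emeasure std_gaussian (space (std_gaussian :: (real^'n) measure)) = 1"
    using emeasure_std_gaussian_product[of "\<lambda>i :: 'n. UNIV"] N.emeasure_space_1
    by simp
qed

section \<open>Power of the spacing test\<close>

text \<open>
  A standard Gaussian vector stays near the ray spanned by \<open>b\<close>, and beyond \<open>T\<close> on it, with
  probability at least a fixed multiple of the one-dimensional tail at \<open>T\<close>.  This expresses the
  independence of \<open>b \<bullet> z\<close> and of the component orthogonal to \<open>b\<close>.  A rotation taking \<open>b\<close> to a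
  coordinate axis turns it into independence of coordinates: the needle with one side
  \<open>{T<..}\<close> and all others \<open>{-1..1}\<close> has a product probability, and its
  cross-section has \<open>l\<^sup>1\<close>-norm at most \<open>CARD('n)\<close>.
\<close>
lemma std_gaussian_near_ray:
  fixes b :: "real^'n"
  assumes b: "norm b = 1"
  shows "\<exists>c>0. \<forall>T. c * Phi_bar T
    \<le> measure std_gaussian {z. T < b \<bullet> z \<and> norm (z - (b \<bullet> z) *\<^sub>R b) \<le> real CARD('n)}"
proof -
  interpret G: prob_space "std_gaussian :: (real^'n) measure" by (rule prob_space_std_gaussian)
  interpret N: real_distribution std_normal_distribution by (rule real_dist_normal_dist)
  obtain k :: 'n where True by simp
  have "norm (axis k 1 :: real^'n) = 1" by simp
  from b this obtain Q where Q: "orthogonal_transformation Q" "Q b = (axis k 1 :: real^'n)"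
    by (rule orthogonal_transformation_exists_1)
  note [measurable] = borel_measurable_orthogonal[OF Q(1)]
  have lin: "linear Q" using Q(1) by (rule orthogonal_transformation_linear)
  define c where "c = measure std_normal_distribution {-1..1} ^ card (UNIV - {k})"
  have "0 < c" unfolding c_def by (intro zero_less_power std_normal_distribution_pos) auto
  moreover have "c * Phi_bar T
      \<le> measure std_gaussian {z. T < b \<bullet> z \<and> norm (z - (b \<bullet> z) *\<^sub>R b) \<le> real CARD('n)}"
    (is "_ \<le> measure _ ?E") for T
  proof -
    define S where "S i = (if i = k then {T<..} else {-1..1})" for i
    let ?box = "{w :: real^'n. \<forall>i. w $ i \<in> S i}"
    have [measurable]: "S i \<in> sets borel" for i by (simp add: S_def)
    have box: "?box \<in> sets borel" by measurable
    have "c * Phi_bar T = (\<Prod>i\<in>UNIV. measure std_normal_distribution (S i))"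
      by (subst prod.remove[of UNIV k]) (auto simp: S_def c_def Phi_bar_eq_measure)
    also have "\<dots> = measure std_gaussian ?box"
      using emeasure_std_gaussian_product[of S]
      by (simp add: G.emeasure_eq_measure N.emeasure_eq_measure prod_ennreal prod_nonneg)
    also have "\<dots> = measure (distr std_gaussian borel Q) ?box"
      by (simp add: distr_std_gaussian_orthogonal[OF Q(1)])
    also have "\<dots> = measure std_gaussian (Q -` ?box)"
      using box by (subst measure_distr) auto
    also have "\<dots> \<le> measure std_gaussian ?E"
    proof (rule G.finite_measure_mono)
      show "Q -` ?box \<subseteq> ?E"
      proof
        fix z assume "z \<in> Q -` ?box"
        then have z: "Q z $ i \<in> S i" for i by auto
        have along: "b \<bullet> z = Q z $ k"
          using Q by (metis orthogonal_transformation_def inner_axis' mult_1 inner_real_def)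
        have "norm (z - (b \<bullet> z) *\<^sub>R b) = norm (Q (z - (b \<bullet> z) *\<^sub>R b))"
          by (simp add: orthogonal_transformation_norm[OF Q(1)])
        also have "\<dots> = norm (Q z - (Q z $ k) *\<^sub>R axis k 1)"
          by (simp add: along linear_diff[OF lin] linear_cmul[OF lin] Q(2))
        also have "\<dots> \<le> (\<Sum>i\<in>UNIV. \<bar>(Q z - (Q z $ k) *\<^sub>R axis k 1) $ i\<bar>)"
          by (rule norm_le_l1_cart)
        also have "\<dots> \<le> (\<Sum>i\<in>(UNIV :: 'n set). 1)"
        proof (rule sum_mono)
          fix i
          show "\<bar>(Q z - (Q z $ k) *\<^sub>R axis k 1) $ i\<bar> \<le> 1"
            using z[of i] by (cases "i = k") (auto simp: S_def axis_def)
        qed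
        also have "\<dots> = real CARD('n)" by simp
        finally show "z \<in> ?E" using z[of k] along by (simp add: S_def)
      qed
    qed (simp, measurable)
    finally show ?thesis .
  qed
  ultimately show ?thesis by blast
qed

text \<open>
  The event that \<open>z\<close> lies in a tube around a ray.  The vector \<open>U = \<mu> + B z\<close> has correlation
  matrix \<open>R\<close>, and \<open>b\<close> is the \<open>i\<close>-th row of \<open>B\<close> with the sign of \<open>\<mu> $ i\<close>.  Along \<open>b\<close>, the
  coordinate \<open>U $ i\<close> is \<open>\<bar>\<mu> $ i\<bar> + b \<bullet> z\<close> up to sign, whereas the residual
  \<open>U $ k - R $ k $ i * U $ i\<close> depends only on the component of \<open>z\<close> orthogonal to \<open>b\<close>, which
  the tube keeps bounded.  Thus \<^const>\<open>lambda2\<close> is bounded by a constant \<open>K\<close>, whereas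
  \<^const>\<open>lambda1\<close> exceeds \<open>T + \<bar>\<mu> $ i\<bar>\<close> although the tube costs only \<open>Phi_bar T\<close>.  This gain of
  \<open>\<bar>\<mu> $ i\<bar>\<close> is the advantage of the alternative over the null hypothesis.
\<close>
lemma gaussian_spacing_stat_lower_bound:
  fixes B :: "real^'n^'p" and \<mu> :: "real^'p"
  assumes R: "R = B ** transpose B" and unit: "\<And>j. R $ j $ j = 1" and "\<mu> $ i \<noteq> 0"
  shows "\<exists>c>0. \<exists>\<kappa>>0. \<exists>T\<^sub>0. \<forall>\<alpha> T. T\<^sub>0 \<le> T \<longrightarrow> Phi_bar (T + \<bar>\<mu> $ i\<bar>) \<le> \<alpha> * \<kappa> \<longrightarrow>
    c * Phi_bar T \<le> measure std_gaussian {z. spacing_stat R (\<mu> + B *v z) \<le> \<alpha>}"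
proof -
  interpret G: prob_space "std_gaussian :: (real^'n) measure" by (rule prob_space_std_gaussian)
  have gram: "R $ j $ k = B $ j \<bullet> B $ k" for j k
    by (simp add: R matrix_matrix_mult_def transpose_def inner_vec_def)
  have norm1: "norm (B $ j) = 1" for j using gram[of j j] unit[of j] by (simp add: norm_eq_1)
  define b where "b = sgn (\<mu> $ i) *\<^sub>R B $ i"
  have sgn2: "sgn (\<mu> $ i) * sgn (\<mu> $ i) = 1" using assms(3) by (simp add: sgn_if)
  have "norm b = 1" using assms(3) by (simp add: b_def norm1 abs_sgn_eq)
  then obtain c where c: "0 < c" "\<And>T. c * Phi_bar T
      \<le> measure std_gaussian {z. T < b \<bullet> z \<and> norm (z - (b \<bullet> z) *\<^sub>R b) \<le> real CARD('n)}"
    using std_gaussian_near_ray[of b] by blast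
  define C where "C = 2 * infnorm \<mu> + real CARD('n)"
  have "0 \<le> C" by (simp add: C_def infnorm_pos_le)
  then obtain K T\<^sub>0 where K: "\<And>u. (\<And>k. \<bar>u $ k - R $ k $ i * u $ i\<bar> \<le> C) \<Longrightarrow> T\<^sub>0 < \<bar>u $ i\<bar> \<Longrightarrow> lambda2 R u \<le> K"
    using lambda2_bounded_near_line[OF gram norm1, of C i] by blast
  have "c * Phi_bar T \<le> measure std_gaussian {z. spacing_stat R (\<mu> + B *v z) \<le> \<alpha>}"
    if T: "T\<^sub>0 \<le> T" and \<alpha>: "Phi_bar (T + \<bar>\<mu> $ i\<bar>) \<le> \<alpha> * Phi_bar K" for \<alpha> T
  proof -
    have "{z. T < b \<bullet> z \<and> norm (z - (b \<bullet> z) *\<^sub>R b) \<le> real CARD('n)}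
        \<subseteq> {z. spacing_stat R (\<mu> + B *v z) \<le> \<alpha>}"
    proof clarify
      fix z
      assume z: "T < b \<bullet> z" "norm (z - (b \<bullet> z) *\<^sub>R b) \<le> real CARD('n)"
      define u where "u = \<mu> + B *v z"
      have u: "u $ k = \<mu> $ k + B $ k \<bullet> z" for k
        by (simp add: u_def matrix_vector_mul_component)
      have "sgn (\<mu> $ i) * u $ i = \<bar>\<mu> $ i\<bar> + b \<bullet> z"
        by (simp add: u b_def algebra_simps abs_sgn)
      moreover have "sgn (\<mu> $ i) * u $ i \<le> \<bar>u $ i\<bar>" by (simp add: sgn_if abs_ge_self abs_ge_minus_self)
      ultimately have far: "T + \<bar>\<mu> $ i\<bar> < \<bar>u $ i\<bar>" using z(1) by simp
      have near: "\<bar>u $ k - R $ k $ i * u $ i\<bar> \<le> C" for k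
      proof -
        have "(B $ k \<bullet> b) * (b \<bullet> z) = (sgn (\<mu> $ i) * sgn (\<mu> $ i)) * (R $ k $ i * (B $ i \<bullet> z))"
          by (simp add: b_def gram)
        then have eq: "u $ k - R $ k $ i * u $ i
            = \<mu> $ k - R $ k $ i * \<mu> $ i + B $ k \<bullet> (z - (b \<bullet> z) *\<^sub>R b)"
          unfolding sgn2 by (simp add: u inner_diff_right algebra_simps)
        have "\<bar>B $ k \<bullet> (z - (b \<bullet> z) *\<^sub>R b)\<bar> \<le> real CARD('n)"
          using Cauchy_Schwarz_ineq2[of "B $ k" "z - (b \<bullet> z) *\<^sub>R b"] z(2) by (simp add: norm1)
        moreover have "\<bar>R $ k $ i * \<mu> $ i\<bar> \<le> 1 * infnorm \<mu>"
          unfolding abs_mult using Cauchy_Schwarz_ineq2[of "B $ k" "B $ i"]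
          by (intro mult_mono component_le_infnorm_cart) (auto simp: gram norm1)
        moreover have "\<bar>\<mu> $ k\<bar> \<le> infnorm \<mu>" by (rule component_le_infnorm_cart)
        ultimately show ?thesis unfolding eq C_def by linarith
      qed
      have "lambda2 R u \<le> K" using near far T by (intro K) auto
      then have "spacing_stat R u \<le> Phi_bar (T + \<bar>\<mu> $ i\<bar>) / Phi_bar K"
        using far by (intro spacing_stat_le[of R u K _ i]) auto
      also have "\<dots> \<le> \<alpha>" using \<alpha> Phi_bar_pos[of K] by (simp add: field_simps)
      finally show "spacing_stat R (\<mu> + B *v z) \<le> \<alpha>" by (simp add: u_def)
    qed
    moreover have "{z. spacing_stat R (\<mu> + B *v z) \<le> \<alpha>} \<in> sets borel"
    proof -
      have "(\<lambda>z. \<mu> + B *v z) \<in> borel_measurable borel"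
        by (intro borel_measurable_continuous_onI continuous_intros)
      from measurable_sets[OF this borel_spacing_stat_le] show ?thesis by (simp add: vimage_def)
    qed
    ultimately have "measure std_gaussian {z. T < b \<bullet> z \<and> norm (z - (b \<bullet> z) *\<^sub>R b) \<le> real CARD('n)}
        \<le> measure std_gaussian {z. spacing_stat R (\<mu> + B *v z) \<le> \<alpha>}"
      by (intro G.finite_measure_mono) (simp_all only: sets_std_gaussian)
    with c(2)[of T] show ?thesis by (rule order_trans)
  qed
  then show ?thesis
    by (intro exI[of _ c] exI[of _ "Phi_bar K"] exI[of _ T\<^sub>0] conjI allI impI c(1) Phi_bar_pos)
qed

theorem theorem5:
  fixes M :: "'a measure"
    and X :: "real^'p^'n" and \<Sigma> :: "real^'n^'n" and \<beta> :: "real^'p"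
    and R :: "real^'p^'p"
    and \<xi> Y :: "'a \<Rightarrow> real^'n" and U :: "'a \<Rightarrow> real^'p"
  assumes "prob_space M"
    and "inj (\<lambda>j. column j X)"
    and "covariance_matrix \<Sigma>"
    and "gaussian_vector M \<xi> 0 \<Sigma>"
    and "Y = (\<lambda>\<omega>. X *v \<beta> + \<xi> \<omega>)"
    and "U = (\<lambda>\<omega>. transpose X *v Y \<omega>)"
    and "R = transpose X ** \<Sigma> ** X"
    and "\<And>i. R $ i $ i = 1"
    and "\<beta> \<notin> {b. X *v b = 0}"
  shows "filterlim (\<lambda>\<alpha>. inverse \<alpha> * \<P>(\<omega> in M. spacing_stat R (U \<omega>) \<le> \<alpha>)) at_top (at_right 0)"
proof -
  have \<xi>_meas [measurable]: "\<xi> \<in> borel_measurable M"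
    and "\<exists>A :: real^'n^'n. A ** transpose A = \<Sigma> \<and>
      distr M borel \<xi> = distr std_gaussian borel (\<lambda>z. 0 + A *v z)"
    using assms(4) unfolding gaussian_vector_def by simp_all
  then obtain A :: "real^'n^'n" where A: "A ** transpose A = \<Sigma>"
    and law: "distr M borel \<xi> = distr std_gaussian borel (\<lambda>z. 0 + A *v z)"
    by (elim exE conjE)
  define \<mu> where "\<mu> = transpose X *v (X *v \<beta>)"
  define B where "B = transpose X ** A"
  have R: "R = B ** transpose B"
    by (simp add: assms(7) A[symmetric] B_def matrix_transpose_mul transpose_transpose matrix_mul_assoc)
  \<comment> \<open>The kernels of \<open>X\<^sup>T X\<close> and \<open>X\<close> coincide.\<close>
  have "\<mu> \<noteq> 0"
  proof
    assume "\<mu> = 0"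
    then have "\<beta> \<bullet> (transpose X *v (X *v \<beta>)) = 0" by (simp add: \<mu>_def)
    then have "(X *v \<beta>) \<bullet> (X *v \<beta>) = 0"
      by (metis dot_lmul_matrix inner_commute transpose_matrix_vector)
    then show False using assms(9) by simp
  qed
  then obtain i where i: "\<mu> $ i \<noteq> 0" by (auto simp: vec_eq_iff)
  have prob: "\<P>(\<omega> in M. spacing_stat R (U \<omega>) \<le> \<alpha>)
      = measure std_gaussian {z. spacing_stat R (\<mu> + B *v z) \<le> \<alpha>}" for \<alpha>
  proof -
    let ?E = "{x. spacing_stat R (\<mu> + transpose X *v x) \<le> \<alpha>}"
    have "(\<lambda>x. \<mu> + transpose X *v x) \<in> borel_measurable borel"
      by (intro borel_measurable_continuous_onI continuous_intros)
    from measurable_sets[OF this borel_spacing_stat_le]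
    have E: "?E \<in> sets borel" by (simp add: vimage_def)
    have A_meas: "(*v) A \<in> borel_measurable std_gaussian"
      by (simp add: measurable_cong_sets[OF sets_std_gaussian refl]
          borel_measurable_continuous_onI matrix_vector_mult_linear_continuous_on)
    have U: "U \<omega> = \<mu> + transpose X *v \<xi> \<omega>" for \<omega>
      by (simp add: assms(5,6) \<mu>_def matrix_vector_right_distrib)
    have "\<P>(\<omega> in M. spacing_stat R (U \<omega>) \<le> \<alpha>) = measure (distr M borel \<xi>) ?E"
      using E by (subst measure_distr) (auto simp: U vimage_def Collect_conj_eq Int_commute)
    also have "\<dots> = measure std_gaussian {z. spacing_stat R (\<mu> + B *v z) \<le> \<alpha>}"
      unfolding law add_0 using E A_meas
      by (subst measure_distr)
        (auto simp: vimage_def B_def matrix_vector_mul_assoc simp del: transpose_matrix_vector)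
    finally show ?thesis .
  qed
  obtain c \<kappa> T\<^sub>0 where "0 < c" "0 < \<kappa>"
    "\<And>\<alpha> T. T\<^sub>0 \<le> T \<Longrightarrow> Phi_bar (T + \<bar>\<mu> $ i\<bar>) \<le> \<alpha> * \<kappa> \<Longrightarrow>
      c * Phi_bar T \<le> measure std_gaussian {z. spacing_stat R (\<mu> + B *v z) \<le> \<alpha>}"
    using gaussian_spacing_stat_lower_bound[OF R assms(8) i] by blast
  then show ?thesis
    unfolding prob using i by (intro filterlim_gaussian_tail_shift[of c \<kappa> "\<bar>\<mu> $ i\<bar>" T\<^sub>0]) auto
qed

end
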